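(* Let $E$ be an almost product structure on a $3$-Bihom-Lie algebra $(L,[\cdot,\cdot,\cdot],\alpha,\beta)$ over a field $\mathbb{K}$. Put $L_+=\{x\in L\mid Ex=x\}$ and $L_-=\{x\in L\mid Ex=-x\}$. If $$[x,y,z]=E[Ex,y,z]+E[x,Ey,z]+E[x,y,Ez]\quad\text{for all }x,y,z\in L,$$ then $E$ is an abelian product structure on $L$ such that $[L_+,L_+,L_-]\subseteq L_+$ and $[L_-,L_-,L_+]\subseteq L_-$.
   Context: A $3$-Bihom-Lie algebra over a field $\mathbb{K}$ is a $4$-tuple $(L,[\cdot,\cdot,\cdot],\alpha,\beta)$ consisting of a $\mathbb{K}$-vector space $L$, a $3$-linear map $[\cdot,\cdot,\cdot]\colon L\times L\times L\to L$ and two linear maps $\alpha,\beta\colon L\to L$ such that for all $x,y,z,u,v\in L$: (1) $\alpha\beta=\beta\alpha$; (2) $\alpha([x,y,z])=[\alpha(x),\alpha(y),\alpha(z)]$ and $\beta([x,y,z])=[\beta(x),\beta(y),\beta(z)]$; (3) $[\beta(x),\beta(y),\alpha(z)]=-[\beta(y),\beta(x),\alpha(z)]=-[\beta(x),\beta(z),\alpha(y)]$; (4) $[\beta^2(u),\beta^2(v),[\beta(x),\beta(y),\alpha(z)]]=[\beta^2(y),\beta^2(z),[\beta(u),\beta(v),\alpha(x)]]-[\beta^2(x),\beta^2(z),[\beta(u),\beta(v),\alpha(y)]]+[\beta^2(x),\beta^2(y),[\beta(u),\beta(v),\alpha(z)]]$. An almost product structure on $L$ is a linear map $E\colon L\to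 L$ with $E^2=\mathrm{Id}$, $E\neq\pm\mathrm{Id}$, $\alpha E=E\alpha$ and $\beta E=E\beta$. An almost product structure $E$ is called an abelian product structure if $[x,y,z]=-[x,Ey,Ez]-[Ex,y,Ez]-[Ex,Ey,z]$ for all $x,y,z\in L$. For subspaces $A,B,C\subseteq L$, $[A,B,C]$ denotes the span of all $[a,b,c]$ with $a\in A$, $b\in B$, $c\in C$.
   Formalization: The field K is additionally assumed to have characteristic different from 2; over F_2 the claim fails, e.g. for L = K[t]/(t^2), [x,y,z] = xyz, α = β = 0, E = Id + d/dt. *)

theory Defs
  imports Main "HOL.Vector_Spaces"
begin

definition trilinear ::
    "('k::field \<Rightarrow> 'a::ab_group_add \<Rightarrow> 'a) \<Rightarrow> ('a \<Rightarrow> 'a \<Rightarrow> 'a \<Rightarrow> 'a) \<Rightarrow> bool" where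
  "trilinear scale br \<longleftrightarrow>
     (\<forall>y z. Vector_Spaces.linear scale scale (\<lambda>x. br x y z)) \<and>
     (\<forall>x z. Vector_Spaces.linear scale scale (\<lambda>y. br x y z)) \<and>
     (\<forall>x y. Vector_Spaces.linear scale scale (\<lambda>z. br x y z))"

text \<open>The underlying vector space is the whole type \<open>'a\<close>, with scalar multiplication \<open>scale\<close>
  by the field \<open>'k\<close>. The structure maps need not be injective or surjective.\<close>

locale three_bihom_lie_algebra = vector_space scale
  for scale :: "'k::field \<Rightarrow> 'a::ab_group_add \<Rightarrow> 'a" +
  fixes br :: "'a \<Rightarrow> 'a \<Rightarrow> 'a \<Rightarrow> 'a"
    and \<alpha> \<beta> :: "'a \<Rightarrow> 'a"
  assumes br_trilinear: "trilinear scale br"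
    and alpha_linear: "Vector_Spaces.linear scale scale \<alpha>"
    and beta_linear: "Vector_Spaces.linear scale scale \<beta>"
    and alpha_beta_commute: "\<alpha> \<circ> \<beta> = \<beta> \<circ> \<alpha>"
    and alpha_br: "\<alpha> (br x y z) = br (\<alpha> x) (\<alpha> y) (\<alpha> z)"
    and beta_br: "\<beta> (br x y z) = br (\<beta> x) (\<beta> y) (\<beta> z)"
    and bihom_skew_12: "br (\<beta> x) (\<beta> y) (\<alpha> z) = - br (\<beta> y) (\<beta> x) (\<alpha> z)"
    and bihom_skew_23: "br (\<beta> x) (\<beta> y) (\<alpha> z) = - br (\<beta> x) (\<beta> z) (\<alpha> y)"
    and bihom_jacobi:
      "br (\<beta> (\<beta> u)) (\<beta> (\<beta> v)) (br (\<beta> x) (\<beta> y) (\<alpha> z)) =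
         br (\<beta> (\<beta> y)) (\<beta> (\<beta> z)) (br (\<beta> u) (\<beta> v) (\<alpha> x))
       - br (\<beta> (\<beta> x)) (\<beta> (\<beta> z)) (br (\<beta> u) (\<beta> v) (\<alpha> y))
       + br (\<beta> (\<beta> x)) (\<beta> (\<beta> y)) (br (\<beta> u) (\<beta> v) (\<alpha> z))"

definition almost_product_structure ::
    "('k::field \<Rightarrow> 'a::ab_group_add \<Rightarrow> 'a) \<Rightarrow> ('a \<Rightarrow> 'a) \<Rightarrow> ('a \<Rightarrow> 'a) \<Rightarrow> ('a \<Rightarrow> 'a) \<Rightarrow> bool" where
  "almost_product_structure scale \<alpha> \<beta> E \<longleftrightarrow>
     Vector_Spaces.linear scale scale E \<and>
     E \<circ> E = id \<and> E \<noteq> id \<and> E \<noteq> (\<lambda>x. - x) \<and>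
     \<alpha> \<circ> E = E \<circ> \<alpha> \<and> \<beta> \<circ> E = E \<circ> \<beta>"

definition abelian_product_structure ::
    "('k::field \<Rightarrow> 'a::ab_group_add \<Rightarrow> 'a) \<Rightarrow> ('a \<Rightarrow> 'a \<Rightarrow> 'a \<Rightarrow> 'a) \<Rightarrow>
     ('a \<Rightarrow> 'a) \<Rightarrow> ('a \<Rightarrow> 'a) \<Rightarrow> ('a \<Rightarrow> 'a) \<Rightarrow> bool" where
  "abelian_product_structure scale br \<alpha> \<beta> E \<longleftrightarrow>
     almost_product_structure scale \<alpha> \<beta> E \<and>
     (\<forall>x y z. br x y z = - br x (E y) (E z) - br (E x) y (E z) - br (E x) (E y) z)"

definition plus_part :: "('a \<Rightarrow> 'a) \<Rightarrow> 'a set" where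
  "plus_part E = {x. E x = x}"

definition minus_part :: "('a::ab_group_add \<Rightarrow> 'a) \<Rightarrow> 'a set" where
  "minus_part E = {x. E x = - x}"

definition br_span ::
    "('k::field \<Rightarrow> 'a::ab_group_add \<Rightarrow> 'a) \<Rightarrow> ('a \<Rightarrow> 'a \<Rightarrow> 'a \<Rightarrow> 'a) \<Rightarrow>
     'a set \<Rightarrow> 'a set \<Rightarrow> 'a set \<Rightarrow> 'a set" where
  "br_span scale br A B C =
     module.span scale {br a b c | a b c. a \<in> A \<and> b \<in> B \<and> c \<in> C}"

end

theory Submission
  imports Defs
begin

text \<open>Applying \<open>E\<close> to the hypothesis shows that \<open>E\<close> acts as a derivation:
  \<open>E[x,y,z] = [Ex,y,z] + [x,Ey,z] + [x,y,Ez]\<close>. Applying this twice and using \<open>E\<^sup>2 = Id\<close> gives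
  \<open>[x,y,z] = 3[x,y,z] + 2([x,Ey,Ez] + [Ex,y,Ez] + [Ex,Ey,z])\<close>, which is twice the abelian identity.
  On eigenvectors the derivation rule adds the eigenvalues, and \<open>1 + 1 - 1 = 1\<close>.\<close>

text \<open>The characteristic assumption enters through this lemma: \<open>v + v\<close> is
  \<open>scale 2 v\<close>, and a nonzero scalar cancels. It removes the factor 2 from the abelian
  identity.\<close>

lemma (in vector_space) double_eq_zeroD:
  fixes v :: 'b
  assumes "(2::'a) \<noteq> 0" and "v + v = 0"
  shows "v = 0"
proof -
  have "scale 2 v = v + v"
    using scale_left_distrib[of 1 1 v] by simp
  with assms show ?thesis
    by simp
qed

lemma (in vector_space) subspace_plus_part:
  assumes "Vector_Spaces.linear scale scale E"
  shows "subspace (plus_part E)"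
proof -
  interpret E: Vector_Spaces.linear scale scale E by fact
  show ?thesis
    by (simp add: subspace_def plus_part_def E.zero E.add E.scale)
qed

lemma (in vector_space) subspace_minus_part:
  assumes "Vector_Spaces.linear scale scale E"
  shows "subspace (minus_part E)"
proof -
  interpret E: Vector_Spaces.linear scale scale E by fact
  show ?thesis
    by (simp add: subspace_def minus_part_def E.zero E.add E.scale)
qed

text \<open>By minimality of the span, containment in an eigenspace of \<open>E\<close> need only be
  checked on single brackets.\<close>

lemma (in vector_space) br_span_subset:
  assumes "subspace S"
    and "\<And>a b c. a \<in> A \<Longrightarrow> b \<in> B \<Longrightarrow> c \<in> C \<Longrightarrow> br a b c \<in> S"
  shows "br_span scale br A B C \<subseteq> S"
  unfolding br_span_def using assms by (intro span_minimal) auto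

theorem proposition3p10:
  fixes scale :: "'k::field \<Rightarrow> 'a::ab_group_add \<Rightarrow> 'a"
    and br :: "'a \<Rightarrow> 'a \<Rightarrow> 'a \<Rightarrow> 'a"
    and \<alpha> \<beta> E :: "'a \<Rightarrow> 'a"
  assumes "three_bihom_lie_algebra scale br \<alpha> \<beta>"
    and char_not_2: "(2::'k) \<noteq> 0"
    and "almost_product_structure scale \<alpha> \<beta> E"
    and "\<And>x y z. br x y z = E (br (E x) y z) + E (br x (E y) z) + E (br x y (E z))"
  shows "abelian_product_structure scale br \<alpha> \<beta> E
       \<and> br_span scale br (plus_part E) (plus_part E) (minus_part E) \<subseteq> plus_part E
       \<and> br_span scale br (minus_part E) (minus_part E) (plus_part E) \<subseteq> minus_part E"
proof -
  interpret three_bihom_lie_algebra scale br \<alpha> \<beta> by fact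
  have lin_E: "Vector_Spaces.linear scale scale E" and "E \<circ> E = id"
    using assms(3) by (simp_all add: almost_product_structure_def)
  then interpret E: Vector_Spaces.linear scale scale E by simp
  have EE: "E (E x) = x" for x
    using \<open>E \<circ> E = id\<close> by (metis comp_apply id_apply)
  have lin_br: "Vector_Spaces.linear scale scale (\<lambda>x. br x y z)"
    "Vector_Spaces.linear scale scale (\<lambda>y. br x y z)"
    "Vector_Spaces.linear scale scale (\<lambda>z. br x y z)" for x y z
    using br_trilinear by (simp_all add: trilinear_def)
  \<comment> \<open>Pulls a sign out of each slot, for arguments with eigenvalue -1.\<close>
  note br_neg = lin_br[THEN linear_iff_module_hom[THEN iffD1], THEN module_hom.neg]
  have derivation: "E (br x y z) = br (E x) y z + br x (E y) z + br x y (E z)" for x y z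
    using arg_cong[OF assms(4)[of x y z], of E] by (simp add: E.add EE)
  have "br x y z = - br x (E y) (E z) - br (E x) y (E z) - br (E x) (E y) z" for x y z
  proof -
    let ?v = "br x y z + br x (E y) (E z) + br (E x) y (E z) + br (E x) (E y) z"
    have "br x y z = E (br (E x) y z) + E (br x (E y) z) + E (br x y (E z))"
      by (rule assms(4))
    \<comment> \<open>Of the nine terms, three carry \<open>E\<close> twice in one slot and collapse
      to \<open>br x y z\<close>; the other six are the mixed brackets, each occurring twice.
      Splitting off one \<open>br x y z\<close> leaves \<open>?v + ?v\<close>.\<close>
    also have "\<dots> = br x y z + (?v + ?v)"
      by (simp only: derivation EE ac_simps)
    finally have "?v + ?v = 0"
      by (metis add_cancel_right_right)
    then have "?v = 0"
      by (rule double_eq_zeroD[OF char_not_2])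
    then show ?thesis
      by (simp add: algebra_simps eq_neg_iff_add_eq_0)
  qed
  then have "abelian_product_structure scale br \<alpha> \<beta> E"
    using assms(3) unfolding abelian_product_structure_def by blast
  moreover have "br_span scale br (plus_part E) (plus_part E) (minus_part E) \<subseteq> plus_part E"
    by (intro br_span_subset subspace_plus_part lin_E)
      (simp add: plus_part_def minus_part_def derivation br_neg)
  \<comment> \<open>Here the eigenvalues add up to -1 - 1 + 1 = -1.\<close>
  moreover have "br_span scale br (minus_part E) (minus_part E) (plus_part E) \<subseteq> minus_part E"
    by (intro br_span_subset subspace_minus_part lin_E)
      (simp add: plus_part_def minus_part_def derivation br_neg)
  ultimately show ?thesis
    by blast
qed

end
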